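(* There is an absolute constant $c>0$ such that for every pair of integers $n$ and $h$ with $0<h<n$, the number $g(h,n)$ of labeled $n$-vertex graphs with obstacle number at most $h$ satisfies $g(h,n)\geq 2^{chn}$, i.e. $g(h,n)\ge 2^{\Omega(hn)}$.
   Context: A geometric drawing of a graph represents its vertices by distinct points in the plane and each edge by the line segment between its endpoints. An obstacle is a polygon in the plane. An obstacle representation of a graph $G$ is a geometric drawing of $G$ together with a set $\mathcal{O}$ of obstacles such that two vertices of $G$ are adjacent if and only if the line segment between the corresponding points is disjoint from all obstacles in $\mathcal{O}$. The obstacle number $\operatorname{obs}(G)$ is the minimum number of obstacles in an obstacle representation of $G$. $g(h,n)$ denotes the number of labeled graphs on the vertex set $\{1,\dots,n\}$ with obstacle number at most $h$. *)

theory Defs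
  imports "HOL-Analysis.Analysis" "HOL-Library.Extended_Nat"
begin

type_synonym point = "real \<times> real"

fun polygonal_path :: "point list \<Rightarrow> real \<Rightarrow> point" where
  "polygonal_path [] = linepath 0 0"
| "polygonal_path [a] = linepath a a"
| "polygonal_path [a, b] = linepath a b"
| "polygonal_path (a # b # c # vs) = linepath a b +++ polygonal_path (b # c # vs)"

text \<open>A polygon is the closed region bounded by a simple closed polygonal curve. The corner list
  repeats its first point at the end. Lists with fewer than three distinct corners are excluded
  by simplicity, and so are the dummy values for short lists.\<close>

definition polygon :: "point set \<Rightarrow> bool" where
  "polygon S \<longleftrightarrow>
     (\<exists>vs. simple_path (polygonal_path vs) \<and>
           pathfinish (polygonal_path vs) = pathstart (polygonal_path vs) \<and>
           S = path_image (polygonal_path vs) \<union> inside (path_image (polygonal_path vs)))"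

definition labeled_graphs :: "nat \<Rightarrow> nat set set set" where
  "labeled_graphs n = Pow {e. e \<subseteq> {1..n} \<and> card e = 2}"

text \<open>The drawing \<open>p\<close> places the vertices; the drawn edges are the segments between their images.
  Only distinct vertices are compared, so a loop is never tested. Neither general position of the
  points nor disjointness of the obstacles is required.\<close>

definition obstacle_representation ::
    "'v set \<Rightarrow> 'v set set \<Rightarrow> ('v \<Rightarrow> point) \<Rightarrow> point set set \<Rightarrow> bool" where
  "obstacle_representation V E p Obs \<longleftrightarrow>
     inj_on p V \<and>
     (\<forall>S\<in>Obs. polygon S) \<and>
     (\<forall>u\<in>V. \<forall>v\<in>V. u \<noteq> v \<longrightarrow>
        ({u, v} \<in> E \<longleftrightarrow> (\<forall>S\<in>Obs. closed_segment (p u) (p v) \<inter> S = {})))"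

text \<open>As an infimum in \<^typ>\<open>enat\<close>, this is the minimum whenever a finite obstacle representation
  exists, and infinity otherwise.\<close>

definition obstacle_number :: "'v set \<Rightarrow> 'v set set \<Rightarrow> enat" where
  "obstacle_number V E =
     Inf {enat (card Obs) | p Obs. finite Obs \<and> obstacle_representation V E p Obs}"

definition num_graphs_obs_le :: "nat \<Rightarrow> nat \<Rightarrow> nat" where
  "num_graphs_obs_le h n =
     card {E \<in> labeled_graphs n. obstacle_number {1..n} E \<le> enat h}"

end

theory Submission
  imports Defs
begin

text \<open>Place a left vertex \<open>i\<close> at \<open>(0, i - 2 e i\<^sup>2)\<close> and a right vertex \<open>j\<close> at \<open>(1, j - 2 e j\<^sup>2)\<close>.
  For small \<open>e\<close> the segments of level \<open>k = i + j\<close> lie on distinct tangents of one parabola near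
  the point \<open>(1/2, k/2)\<close>, far from the segments of the other levels. A single obstacle above this
  parabola can reach down to the tangency points of any prescribed set of these segments without
  meeting another segment. With about \<open>n/4\<close> free segments on each of about \<open>min h (n/4)\<close> levels,
  each using one obstacle, the at least \<open>2 ^ (h n / 16)\<close> choices give different graphs.\<close>

section \<open>Polygons over a monotone chain\<close>

lemma pathstart_polygonal_path [simp]: "pathstart (polygonal_path (a # vs)) = a"
  by (cases "(a # vs)" rule: polygonal_path.cases) auto

lemma pathfinish_polygonal_path [simp]:
  "vs \<noteq> [] \<Longrightarrow> pathfinish (polygonal_path vs) = last vs"
  by (induction vs rule: polygonal_path.induct) auto

lemma path_image_polygonal_path_Cons:
  "path_image (polygonal_path (a # b # vs)) =
     closed_segment a b \<union> path_image (polygonal_path (b # vs))"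
  by (cases vs) (auto simp: path_image_join)

lemma vertices_subset_path_image:
  "vs \<noteq> [] \<Longrightarrow> set vs \<subseteq> path_image (polygonal_path vs)"
proof (induction vs rule: induct_list012)
  case (3 a b vs)
  then show ?case
    by (simp only: path_image_polygonal_path_Cons) auto
qed auto

lemma path_image_subset_convex:
  assumes "vs \<noteq> []" "set vs \<subseteq> C" "convex C"
  shows "path_image (polygonal_path vs) \<subseteq> C"
  using assms
proof (induction vs rule: induct_list012)
  case (3 a b vs)
  then show ?case
    by (simp only: path_image_polygonal_path_Cons) (auto dest: closed_segment_subset)
qed auto

lemma closed_segment_fst_eq_end:
  fixes a b z :: point
  assumes "z \<in> closed_segment a b" "fst a < fst b"
  shows "fst z \<le> fst b" "fst z = fst b \<Longrightarrow> z = b"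
proof -
  obtain u where u: "0 \<le> u" "u \<le> 1" "z = (1 - u) *\<^sub>R a + u *\<^sub>R b"
    using assms(1) by (auto simp: in_segment)
  then have *: "fst b - fst z = (1 - u) * (fst b - fst a)"
    by (simp add: left_diff_distrib right_diff_distrib)
  then have "fst b - fst z \<ge> 0"
    using u assms(2) by simp
  then show "fst z \<le> fst b" by simp
  show "z = b" if "fst z = fst b"
    using that * assms(2) u by simp
qed

lemma closed_segment_snd_eq_end:
  fixes a b z :: point
  assumes "z \<in> closed_segment a b" "snd a < snd b" "snd z \<ge> snd b"
  shows "z = b"
proof -
  obtain u where u: "0 \<le> u" "u \<le> 1" "z = (1 - u) *\<^sub>R a + u *\<^sub>R b"
    using assms(1) by (auto simp: in_segment)
  then have *: "snd b - snd z = (1 - u) * (snd b - snd a)"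
    by (simp add: left_diff_distrib right_diff_distrib)
  then have "(1 - u) * (snd b - snd a) \<le> 0"
    using assms(3) by simp
  then have "u = 1"
    using u assms(2) by (auto simp: mult_le_0_iff)
  then show "z = b" using u by simp
qed

text \<open>The vertical line through \<open>b\<close> separates the first edge from the rest of the
  chain, so the two can meet only in \<open>b\<close>.\<close>

lemma arc_polygonal_path_monotone:
  assumes "length vs \<ge> 2" "sorted_wrt (\<lambda>a b. fst a < fst b) vs"
  shows "arc (polygonal_path vs)"
  using assms
proof (induction vs rule: polygonal_path.induct)
  case (3 a b)
  then show ?case by (auto intro!: arc_linepath)
next
  case (4 a b c vs)
  have "arc (linepath a b +++ polygonal_path (b # c # vs))"
  proof (rule arc_join)
    show "arc (linepath a b)" using 4 by (intro arc_linepath) auto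
    show "arc (polygonal_path (b # c # vs))" using 4 by auto
    have "path_image (polygonal_path (b # c # vs)) \<subseteq> {z. fst z \<ge> fst b}"
    proof (rule path_image_subset_convex)
      show "convex {z :: point. fst b \<le> fst z}"
        using convex_halfspace_ge[of "fst b" "(1, 0) :: point"] by (simp add: inner_prod_def)
    qed (use 4 in auto)
    then show "path_image (linepath a b) \<inter> path_image (polygonal_path (b # c # vs))
        \<subseteq> {pathstart (polygonal_path (b # c # vs))}"
      using closed_segment_fst_eq_end[of _ a b] 4(3)
      by (fastforce simp del: polygonal_path.simps)
  qed simp
  then show ?case by simp
qed auto

text \<open>Every edge but the last lies in the open half-plane below \<open>b\<close>, and the last
  one rises to this height only at \<open>b\<close>. Hence a horizontal closing edge at the height
  of \<open>b\<close> can touch this chain only there.\<close>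

lemma path_image_top_end:
  assumes "vs \<noteq> []" "\<forall>v\<in>set vs. snd v < snd b"
    and "z \<in> path_image (polygonal_path (vs @ [b]))" "snd z \<ge> snd b"
  shows "z = b"
  using assms
proof (induction vs rule: induct_list012)
  case (2 a)
  then show ?case using closed_segment_snd_eq_end[of z a b] by auto
next
  case (3 a c vs)
  have "closed_segment a c \<subseteq> {z. snd z < snd b}"
  proof (rule closed_segment_subset)
    show "convex {z :: point. snd z < snd b}"
      using convex_halfspace_lt[of "(0, 1) :: point" "snd b"] by (simp add: inner_prod_def)
  qed (use 3 in auto)
  then show ?case
    using 3 by (auto simp: path_image_polygonal_path_Cons simp del: polygonal_path.simps)
qed auto

text \<open>The chain hangs below the horizontal edge from \<open>b\<close> to \<open>a\<close>,
  which closes it to a simple curve. The hull bound reduces the later disjointness proofs to a check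
  of the corners.\<close>

lemma polygon_monotone_chain:
  assumes sorted: "sorted_wrt (\<lambda>a b. fst a < fst b) (a # vs @ [b])"
    and "vs \<noteq> []" and top: "snd a = snd b" and below: "\<forall>v\<in>set vs. snd v < snd b"
  obtains S where "polygon S" "set (a # vs @ [b]) \<subseteq> S" "S \<subseteq> convex hull set (a # vs @ [b])"
proof -
  let ?chain = "polygonal_path (a # vs @ [b])"
  let ?g = "polygonal_path (b # a # vs @ [b])"
  let ?H = "convex hull set (a # vs @ [b])"
  obtain v ws where vs: "vs = v # ws" using \<open>vs \<noteq> []\<close> by (cases vs) auto
  have g: "?g = linepath b a +++ ?chain" by (simp add: vs)
  have meet: "z \<in> {a, b}" if z: "z \<in> closed_segment b a" "z \<in> path_image ?chain" for z
  proof -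
    have "snd z = snd b"
      using z(1) top by (auto simp: in_segment left_diff_distrib)
    \<comment> \<open>The edge leaving \<open>a\<close> is treated apart: the inner corners lie
      below \<open>a\<close> as well, so \<open>path_image_top_end\<close> applies only to the chain
      after \<open>a\<close>.\<close>
    from z(2) consider "z \<in> closed_segment a v" | "z \<in> path_image (polygonal_path (vs @ [b]))"
      by (auto simp: vs path_image_polygonal_path_Cons simp del: polygonal_path.simps)
    then show ?thesis
    proof cases
      case 1
      then show ?thesis
        using closed_segment_snd_eq_end[of z v a] \<open>snd z = snd b\<close> top below
        by (auto simp: vs closed_segment_commute)
    next
      case 2
      then show ?thesis
        using path_image_top_end[of vs b z] \<open>snd z = snd b\<close> below \<open>vs \<noteq> []\<close> by auto
    qed
  qed
  have "simple_path ?g"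
    unfolding g
  proof (rule simple_path_join_loop)
    show "arc (linepath b a)" using sorted by (intro arc_linepath) auto
    show "arc ?chain" using sorted by (intro arc_polygonal_path_monotone) auto
  qed (use meet in \<open>auto simp del: polygonal_path.simps\<close>)
  moreover have "pathfinish ?g = pathstart ?g"
    by (simp del: polygonal_path.simps)
  moreover have image: "path_image ?g \<subseteq> ?H"
    by (rule path_image_subset_convex) (auto simp: hull_inc)
  \<comment> \<open>The complement of a convex set containing the curve lies in the outside of the
    curve.\<close>
  then have "inside (path_image ?g) \<subseteq> ?H"
    using outside_subset_convex[OF convex_convex_hull image] inside_Int_outside by blast
  moreover have "set (a # vs @ [b]) \<subseteq> path_image ?g"
    using vertices_subset_path_image[of "b # a # vs @ [b]"] by auto
  ultimately show thesis
    using image that[of "path_image ?g \<union> inside (path_image ?g)"]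
    unfolding polygon_def by blast
qed

section \<open>Tangents of a parabola\<close>

text \<open>For \<open>e = 0\<close> all segments with the same \<open>i + j\<close> would pass
  through one point above 1/2. The quadratic term pulls them apart into tangents of a
  parabola.\<close>

definition height :: "real \<Rightarrow> real \<Rightarrow> real" where
  "height e i = i - 2 * e * i\<^sup>2"

definition line_at :: "real \<Rightarrow> real \<Rightarrow> real \<Rightarrow> real \<Rightarrow> real" where
  "line_at e i j x = (1 - x) * height e i + x * height e j"

text \<open>In the affine coordinates \<open>(s, w)\<close> of level \<open>k\<close>, the line of the pair \<open>(i, j)\<close> with
  \<open>i + j = k\<close> and \<open>u = j - i\<close> is \<open>w = s u - u\<^sup>2 / 2\<close>, the tangent at \<open>s = u\<close> of \<open>w = s\<^sup>2 / 2\<close>.\<close>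

definition corner :: "real \<Rightarrow> real \<Rightarrow> real \<Rightarrow> real \<Rightarrow> point" where
  "corner e k s w = (1/2 + e * s / (1 - 2 * e * k), k/2 - e * k\<^sup>2 / 2 + e * w)"

text \<open>The vertical distance splits into a term for the difference of levels and a term of
  order \<open>e\<close>. The line has slope \<open>(j - i) * (1 - 2 * e * (i + j))\<close>, and the
  denominator in \<open>corner\<close> cancels the second factor when the levels agree.\<close>

lemma corner_minus_line:
  "snd (corner e k s w) - line_at e i j (fst (corner e k s w)) =
    (k - (i + j)) / 2 * (1 - e * (k + (i + j)))
    + e * (w + (j - i)\<^sup>2 / 2 - s * (j - i) * ((1 - 2 * e * (i + j)) / (1 - 2 * e * k)))"
proof -
  \<comment> \<open>The identity is polynomial in this reciprocal, so no case distinction on a zero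
    denominator arises.\<close>
  define r where "r = 1 / (1 - 2 * e * k)"
  have c: "corner e k s w = (1/2 + e * s * r, k/2 - e * k\<^sup>2 / 2 + e * w)"
    by (simp add: corner_def r_def)
  have q: "(1 - 2 * e * (i + j)) / (1 - 2 * e * k) = (1 - 2 * e * (i + j)) * r"
    by (simp add: r_def)
  show ?thesis
    unfolding c q line_at_def height_def by (simp add: field_simps power2_eq_square)
qed

lemma corner_above_tangent:
  assumes "2 * e * (i + j) < 1" "0 < e" "s * (j - i) < w + (j - i)\<^sup>2 / 2"
  shows "snd (corner e (i + j) s w) > line_at e i j (fst (corner e (i + j) s w))"
proof -
  have "snd (corner e (i + j) s w) - line_at e i j (fst (corner e (i + j) s w))
      = e * (w + (j - i)\<^sup>2 / 2 - s * (j - i))"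
    using corner_minus_line[of e "i + j" s w i j] assms(1) by simp
  also have "\<dots> > 0" using assms by simp
  finally show ?thesis by simp
qed

lemma corner_on_tangent:
  assumes "2 * e * (i + j) < 1"
  shows "snd (corner e (i + j) (j - i) ((j - i)\<^sup>2 / 2))
    = line_at e i j (fst (corner e (i + j) (j - i) ((j - i)\<^sup>2 / 2)))"
  using corner_minus_line[of e "i + j" "j - i" "(j - i)\<^sup>2 / 2" i j] assms(1)
  by (simp add: power2_eq_square)


text \<open>With this \<open>e\<close>, any product of two quantities of size at most
  \<open>n\<close> contributes at most 1/16 after scaling by \<open>e\<close>;
  \<open>n \<le> n\<^sup>2\<close> gives the same bound for a single quantity.\<close>

lemma small_parameter:
  fixes n e x :: real
  assumes "1 \<le> n" "e = 1 / (16 * n\<^sup>2)"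
  shows "0 < e" "e * n\<^sup>2 = 1/16" "x \<le> n \<Longrightarrow> e * x \<le> 1/16"
proof -
  show e: "0 < e" and en2: "e * n\<^sup>2 = 1/16" using assms by auto
  assume "x \<le> n"
  also have "n \<le> n\<^sup>2" using assms(1) by (intro self_le_power) auto
  finally have "e * x \<le> e * n\<^sup>2" using e by simp
  then show "e * x \<le> 1/16" using en2 by simp
qed

text \<open>Levels differ by at least 1, so the level term has size at least 7/16. The other terms
  are bounded by 1/16, 1/32 and 1/14 and cannot change the sign.\<close>

lemma corner_other_level:
  assumes n: "1 \<le> n" and e: "e = 1 / (16 * n\<^sup>2)"
    and k: "0 \<le> k" "k \<le> n" and ij: "0 \<le> i + j" "i + j \<le> n"
    and "\<bar>s\<bar> \<le> n" "\<bar>j - i\<bar> \<le> n" "0 \<le> w" "w \<le> n\<^sup>2"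
  shows corner_above_lower_level: "i + j + 1 \<le> k \<Longrightarrow>
      line_at e i j (fst (corner e k s w)) < snd (corner e k s w)"
    and corner_below_higher_level: "k + 1 \<le> i + j \<Longrightarrow>
      snd (corner e k s w) < line_at e i j (fst (corner e k s w))"
proof -
  define r where "r = (1 - 2 * e * (i + j)) / (1 - 2 * e * k)"
  define u where "u = j - i"
  note e0 = small_parameter(1)[OF n e] and en2 = small_parameter(2)[OF n e]
  have small: "0 \<le> e * x" "e * x \<le> 1/16" if "0 \<le> x" "x \<le> n" for x
    using that e0 small_parameter(3)[OF n e] by auto
  \<comment> \<open>The numerator lies between 7/8 and 1, and the denominator is at least
    7/8.\<close>
  have "0 \<le> r" "r \<le> 8/7"
    using small[OF k] small[OF ij] by (auto simp: r_def divide_simps algebra_simps)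
  moreover have "e * \<bar>s * u\<bar> \<le> 1/16"
    using mult_mono[of "\<bar>s\<bar>" n "\<bar>u\<bar>" n] assms e0 en2 mult_left_mono[of "\<bar>s * u\<bar>" "n * n" e]
    by (simp add: abs_mult u_def flip: power2_eq_square)
  ultimately have "e * \<bar>s * u\<bar> * r \<le> 1/16 * (8/7)"
    using e0 by (intro mult_mono) auto
  moreover have "\<bar>e * (s * u * r)\<bar> = e * \<bar>s * u\<bar> * r"
    using e0 \<open>0 \<le> r\<close> by (simp add: abs_mult)
  ultimately have cross: "\<bar>e * (s * u * r)\<bar> \<le> 1/14" by linarith
  have w: "0 \<le> e * w" "e * w \<le> 1/16"
    using assms e0 en2 mult_left_mono[of w "n\<^sup>2" e] by auto
  have "u\<^sup>2 \<le> n\<^sup>2"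
    using assms n by (simp add: u_def abs_le_square_iff[symmetric])
  then have "e * u\<^sup>2 \<le> e * n\<^sup>2" using e0 by simp
  then have u: "0 \<le> e * u\<^sup>2" "e * u\<^sup>2 \<le> 1/16"
    using e0 en2 by auto
  define m where "m = 1 - e * (k + (i + j))"
  have m: "7/8 \<le> m" using small[OF k] small[OF ij] by (simp add: m_def algebra_simps)
  have eq: "snd (corner e k s w) - line_at e i j (fst (corner e k s w))
      = (k - (i + j)) / 2 * m + e * w + e * u\<^sup>2 / 2 - e * (s * u * r)"
    unfolding corner_minus_line by (simp add: r_def u_def m_def algebra_simps)
  show "line_at e i j (fst (corner e k s w)) < snd (corner e k s w)" if "i + j + 1 \<le> k"
  proof -
    have "1/2 * (7/8) \<le> (k - (i + j)) / 2 * m"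
      using that m by (intro mult_mono) auto
    then show ?thesis using eq cross w u by linarith
  qed
  show "snd (corner e k s w) < line_at e i j (fst (corner e k s w))" if "k + 1 \<le> i + j"
  proof -
    have "1/2 * (7/8) \<le> ((i + j) - k) / 2 * m"
      using that m by (intro mult_mono) auto
    moreover have "(k - (i + j)) / 2 * m = - (((i + j) - k) / 2 * m)"
      by (simp add: field_simps)
    ultimately show ?thesis using eq cross w u by linarith
  qed
qed

text \<open>The two extra corners at height \<open>n\<^sup>2\<close> keep the polygon nondegenerate when \<open>U\<close> has fewer than
  three elements.\<close>

definition obstacle_corners :: "real \<Rightarrow> real \<Rightarrow> real \<Rightarrow> real set \<Rightarrow> point set" where
  "obstacle_corners n e k U =
     (\<lambda>(s, w). corner e k s w) ` ({(- n, n\<^sup>2), (n, n\<^sup>2)} \<union> (\<lambda>u. (u, u\<^sup>2 / 2)) ` U)"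

section \<open>The obstacle of one level and the segments that it misses\<close>

lemma polygon_with_obstacle_corners:
  assumes n: "1 \<le> n" and e: "0 < e" "2 * e * k < 1"
    and U: "finite U" "U \<noteq> {}" "\<forall>u\<in>U. \<bar>u\<bar> < n"
  obtains P where "polygon P" "obstacle_corners n e k U \<subseteq> P"
    "P \<subseteq> convex hull obstacle_corners n e k U"
proof -
  define c where "c u = corner e k u (u\<^sup>2 / 2)" for u
  let ?a = "corner e k (- n) (n\<^sup>2)" and ?b = "corner e k n (n\<^sup>2)"
  let ?vs = "map c (sorted_list_of_set U)"
  have mono: "fst (corner e k s w) < fst (corner e k s' w')" if "s < s'" for s s' w w'
    using that e by (simp add: corner_def divide_strict_right_mono)
  have corners: "set (?a # ?vs @ [?b]) = obstacle_corners n e k U"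
    using U by (simp add: obstacle_corners_def c_def image_image insert_commute)
  show thesis
  proof (rule polygon_monotone_chain[of ?a ?vs ?b, unfolded corners])
    \<comment> \<open>The first coordinate of \<open>corner\<close> increases with \<open>s\<close>,
      so sorting \<open>U\<close> makes the tangency points a monotone chain between the two top
      corners.\<close>
    have "sorted_wrt (\<lambda>x y. fst (c x) < fst (c y)) (sorted_list_of_set U)"
      by (rule sorted_wrt_mono_rel[OF _ strict_sorted_list_of_set]) (simp add: c_def mono)
    then show "sorted_wrt (\<lambda>a b. fst a < fst b) (?a # ?vs @ [?b])"
      using U n mono by (auto simp: sorted_wrt_append sorted_wrt_map c_def)
    show "?vs \<noteq> []" using U by auto
    show "snd ?a = snd ?b" by (simp add: corner_def)
    have "u\<^sup>2 / 2 < n\<^sup>2" if "u \<in> U" for u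
    proof -
      have "u\<^sup>2 \<le> n\<^sup>2" using that U n by (auto simp: abs_le_square_iff[symmetric] less_imp_le)
      moreover have "0 < n\<^sup>2" using n by simp
      ultimately show ?thesis by linarith
    qed
    then show "\<forall>v\<in>set ?vs. snd v < snd ?b"
      using U e by (auto simp: c_def corner_def)
  qed (use that in auto)
qed

lemma convex_above_line: "convex {z :: point. line_at e i j (fst z) < snd z}"
proof -
  have "{z :: point. line_at e i j (fst z) < snd z}
      = {z. (height e i - height e j, 1) \<bullet> z > height e i}"
    by (auto simp: line_at_def inner_prod_def algebra_simps)
  then show ?thesis by (simp only: convex_halfspace_gt)
qed

lemma convex_below_line: "convex {z :: point. snd z < line_at e i j (fst z)}"
proof -
  have "{z :: point. snd z < line_at e i j (fst z)}
      = {z. (height e i - height e j, 1) \<bullet> z < height e i}"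
    by (auto simp: line_at_def inner_prod_def algebra_simps)
  then show ?thesis by (simp only: convex_halfspace_lt)
qed

text \<open>All corners lie strictly on one side of the line, hence so does their hull. On another
  level this is the separation of levels; on the same level the line is a tangent whose point of
  tangency is not a corner.\<close>

lemma obstacle_hull_misses_line:
  assumes n: "1 \<le> n" and e: "e = 1 / (16 * n\<^sup>2)"
    and k: "0 \<le> k" "k \<le> n" and ij: "0 \<le> i + j" "i + j \<le> n" "\<bar>j - i\<bar> \<le> n"
    and U: "\<forall>u\<in>U. \<bar>u\<bar> \<le> n"
    and level: "k = i + j \<and> j - i \<notin> U \<or> i + j + 1 \<le> k \<or> k + 1 \<le> i + j"
    and z: "z \<in> convex hull obstacle_corners n e k U"
  shows "snd z \<noteq> line_at e i j (fst z)"
proof -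
  have e0: "0 < e" using n e by auto
  let ?I = "{(- n, n\<^sup>2), (n, n\<^sup>2)} \<union> (\<lambda>u. (u, u\<^sup>2 / 2)) ` U"
  have range: "\<bar>s\<bar> \<le> n" "0 \<le> w" "w \<le> n\<^sup>2" if "(s, w) \<in> ?I" for s w
  proof -
    have *: "u\<^sup>2 / 2 \<le> n\<^sup>2" if "u \<in> U" for u
    proof -
      have "u\<^sup>2 \<le> n\<^sup>2" using that U n by (simp add: abs_le_square_iff[symmetric])
      moreover have "0 \<le> n\<^sup>2" by simp
      ultimately show ?thesis by linarith
    qed
    then show "\<bar>s\<bar> \<le> n" "0 \<le> w" "w \<le> n\<^sup>2" using that U n by auto
  qed
  have "obstacle_corners n e k U \<subseteq> {z. line_at e i j (fst z) < snd z} \<or>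
      obstacle_corners n e k U \<subseteq> {z. snd z < line_at e i j (fst z)}"
    using level
  proof (elim disjE conjE)
    assume k_eq: "k = i + j" and notin: "j - i \<notin> U"
    have "2 * e * (i + j) < 1"
      using small_parameter(3)[OF n e, of "i + j"] ij by simp
    moreover have "s * (j - i) < w + (j - i)\<^sup>2 / 2" if "(s, w) \<in> ?I" for s w
    proof -
      \<comment> \<open>Completing the square: twice the scaled height above the tangent is the
        squared distance to its point of tangency plus twice the height
        \<open>w - s\<^sup>2 / 2\<close> above the parabola. The top corners make the second part
        positive, the corners from \<open>U\<close> the first.\<close>
      have "0 < (s - (j - i))\<^sup>2 + 2 * w - s\<^sup>2"
      proof (cases "w = n\<^sup>2 \<and> s\<^sup>2 = n\<^sup>2")
        case True
        moreover have "0 < n\<^sup>2" "0 \<le> (s - (j - i))\<^sup>2" using n by auto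
        ultimately show ?thesis by linarith
      next
        case False
        then have "w = s\<^sup>2 / 2" "s \<in> U" using that by auto
        moreover from this notin have "0 < (s - (j - i))\<^sup>2" by auto
        ultimately show ?thesis by linarith
      qed
      then show ?thesis by (simp add: power2_eq_square field_simps)
    qed
    ultimately show ?thesis
      using e0 by (auto simp: obstacle_corners_def k_eq intro!: corner_above_tangent)
  next
    assume "i + j + 1 \<le> k"
    then have "line_at e i j (fst (corner e k s w)) < snd (corner e k s w)" if "(s, w) \<in> ?I" for s w
      using corner_above_lower_level[OF n e k ij(1,2) range(1)[OF that] ij(3) range(2,3)[OF that]]
      by simp
    then show ?thesis by (simp add: obstacle_corners_def image_subset_iff split_beta)
  next
    assume "k + 1 \<le> i + j"
    then have "snd (corner e k s w) < line_at e i j (fst (corner e k s w))" if "(s, w) \<in> ?I" for s w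
      using corner_below_higher_level[OF n e k ij(1,2) range(1)[OF that] ij(3) range(2,3)[OF that]]
      by simp
    then show ?thesis by (simp add: obstacle_corners_def image_subset_iff split_beta)
  qed
  then show ?thesis
  proof
    assume "obstacle_corners n e k U \<subseteq> {z. line_at e i j (fst z) < snd z}"
    from subsetD[OF hull_minimal[of _ _ convex, OF this convex_above_line] z]
    show ?thesis by simp
  next
    assume "obstacle_corners n e k U \<subseteq> {z. snd z < line_at e i j (fst z)}"
    from subsetD[OF hull_minimal[of _ _ convex, OF this convex_below_line] z]
    show ?thesis by simp
  qed
qed

text \<open>This keeps obstacles off the two vertical lines that carry the vertices, and so off all
  segments between vertices of one side.\<close>

lemma obstacle_hull_in_strip:
  assumes n: "1 \<le> n" and e: "e = 1 / (16 * n\<^sup>2)" and k: "0 \<le> k" "k \<le> n"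
    and U: "\<forall>u\<in>U. \<bar>u\<bar> \<le> n"
    and z: "z \<in> convex hull obstacle_corners n e k U"
  shows "0 < fst z" "fst z < 1"
proof -
  note e0 = small_parameter(1)[OF n e]
  have ek: "e * k \<le> 1/16" using small_parameter(3)[OF n e] k by auto
  have shift: "\<bar>e * s / (1 - 2 * e * k)\<bar> < 1/2" if "\<bar>s\<bar> \<le> n" for s
  proof -
    have "\<bar>e * s\<bar> \<le> 1/16"
      using small_parameter(3)[OF n e that] e0 by (simp add: abs_mult)
    then show ?thesis using ek by (simp add: abs_mult divide_simps)
  qed
  have in_strip: "0 < fst (corner e k s w) \<and> fst (corner e k s w) < 1" if "\<bar>s\<bar> \<le> n" for s w
    using shift[OF that] unfolding corner_def fst_conv by linarith
  have "convex {z :: point. 0 < fst z \<and> fst z < 1}"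
  proof -
    have "{z :: point. 0 < fst z \<and> fst z < 1} = {0<..<1} \<times> UNIV" by auto
    then show ?thesis by (simp add: convex_Times)
  qed
  moreover have "obstacle_corners n e k U \<subseteq> {z. 0 < fst z \<and> fst z < 1}"
    using in_strip U n by (auto simp: obstacle_corners_def)
  ultimately show "0 < fst z" "fst z < 1"
    using z hull_minimal[of _ "{z. 0 < fst z \<and> fst z < 1}" convex] by blast+
qed


lemma closed_segment_eq_line:
  "closed_segment (0, height e i) (1, height e j) = (\<lambda>x. (x, line_at e i j x)) ` {0..1}"
  by (auto simp: closed_segment_def line_at_def image_def)

lemma level_obstacle:
  assumes n: "1 \<le> n" and e: "e = 1 / (16 * (real n)\<^sup>2)"
    and k: "k \<le> n" and S: "finite S" "i0 \<in> S" "\<forall>i\<in>S. 1 \<le> i \<and> i < k"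
  obtains P where "polygon P" "\<forall>z\<in>P. 0 < fst z \<and> fst z < 1"
    "\<And>i j. i + j = k \<Longrightarrow> i \<in> S \<Longrightarrow>
       closed_segment (0, height e (real i)) (1, height e (real j)) \<inter> P \<noteq> {}"
    "\<And>i j. i + j \<le> n \<Longrightarrow> i + j = k \<longrightarrow> i \<notin> S \<Longrightarrow>
       closed_segment (0, height e (real i)) (1, height e (real j)) \<inter> P = {}"
proof -
  \<comment> \<open>For \<open>j = k - i\<close> this is the tangent parameter
    \<open>j - i\<close>.\<close>
  define U where "U = (\<lambda>i. real k - 2 * real i) ` S"
  have n': "1 \<le> real n" and k': "0 \<le> real k" "real k \<le> real n" using n k by auto
  have "2 * e * real k < 1"
    using small_parameter(3)[OF n' e, of "real k"] k by simp
  moreover have U: "finite U" "U \<noteq> {}" "\<forall>u\<in>U. \<bar>u\<bar> < real n"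
    using S k by (auto simp: U_def abs_less_iff)
  ultimately obtain P where P: "polygon P" "obstacle_corners n e k U \<subseteq> P"
    "P \<subseteq> convex hull obstacle_corners n e k U"
    using polygon_with_obstacle_corners[OF n' small_parameter(1)[OF n' e]] by blast
  have U': "\<forall>u\<in>U. \<bar>u\<bar> \<le> real n" using U(3) by auto
  have strip: "\<forall>z\<in>P. 0 < fst z \<and> fst z < 1"
    using obstacle_hull_in_strip[OF n' e k' U'] P(3) by auto
  show thesis
  proof (rule that[OF P(1) strip])
    fix i j :: nat assume ij: "i + j = k" and "i \<in> S"
    let ?c = "corner e (real i + real j) (real j - real i) ((real j - real i)\<^sup>2 / 2)"
    have kij: "real k = real i + real j" using ij by auto
    have "real j - real i \<in> U" using \<open>i \<in> S\<close> kij by (auto simp: U_def image_iff)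
    \<comment> \<open>The point of tangency is a corner of the obstacle; the strip then places it on
      the segment and not only on its line.\<close>
    then have "?c \<in> P" using P(2) unfolding obstacle_corners_def kij by auto
    moreover from this strip have "0 < fst ?c" "fst ?c < 1" by auto
    moreover have "?c = (fst ?c, line_at e i j (fst ?c))"
      using corner_on_tangent[of e "real i" "real j"] \<open>2 * e * real k < 1\<close> kij
      by (simp add: prod_eq_iff)
    ultimately show "closed_segment (0, height e (real i)) (1, height e (real j)) \<inter> P \<noteq> {}"
      unfolding closed_segment_eq_line by fastforce
  next
    fix i j :: nat assume ij: "i + j \<le> n" "i + j = k \<longrightarrow> i \<notin> S"
    have level: "real k = real i + real j \<and> real j - real i \<notin> U \<or> real i + real j + 1 \<le> real k \<or>
        real k + 1 \<le> real i + real j"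
    proof (cases "i + j" k rule: linorder_cases)
      case equal
      then have "real j - real i \<notin> U" using ij by (auto simp: U_def)
      then show ?thesis using equal by auto
    qed linarith+
    have "0 \<le> real i + real j" "real i + real j \<le> real n" "\<bar>real j - real i\<bar> \<le> real n"
      using ij by auto
    note obstacle_hull_misses_line[OF n' e k' this U' level]
    then show "closed_segment (0, height e (real i)) (1, height e (real j)) \<inter> P = {}"
      using P(3) unfolding closed_segment_eq_line by force
  qed
qed

section \<open>Counting the graphs\<close>

definition placement :: "nat \<Rightarrow> real \<Rightarrow> nat \<Rightarrow> point" where
  "placement q e v = (if v \<le> q then (0, height e (real v)) else (1, height e (real (v - q))))"

text \<open>A pair of a left and a right vertex is encoded as (left vertex, level).\<close>

definition blocked_pair :: "nat \<Rightarrow> nat \<times> nat \<Rightarrow> nat set" where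
  "blocked_pair q = (\<lambda>(i, k). {i, q + (k - i)})"

definition graph_without :: "nat \<Rightarrow> nat \<Rightarrow> (nat \<times> nat) set \<Rightarrow> nat set set" where
  "graph_without n q S = {e. e \<subseteq> {1..n} \<and> card e = 2} - blocked_pair q ` S"

section \<open>The drawing and its obstacle number\<close>

lemma height_inj:
  assumes n: "1 \<le> n" and e: "e = 1 / (16 * n\<^sup>2)"
    and "0 \<le> x" "x \<le> n" "0 \<le> y" "y \<le> n" "height e x = height e y"
  shows "x = y"
proof -
  have "(x - y) * (1 - 2 * e * x - 2 * e * y) = height e x - height e y"
    by (simp add: height_def power2_eq_square algebra_simps)
  \<comment> \<open>Both subtracted terms are at most 1/8.\<close>
  moreover have "1 - 2 * e * x - 2 * e * y \<noteq> 0"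
    using small_parameter(3)[OF n e, of x] small_parameter(3)[OF n e, of y] assms(4,6)
    by (auto simp: mult.assoc)
  ultimately show ?thesis using assms by simp
qed

lemma inj_on_placement:
  assumes "1 \<le> n" "e = 1 / (16 * (real n)\<^sup>2)"
  shows "inj_on (placement q e) {1..n}"
proof (rule inj_onI)
  fix u v assume uv: "u \<in> {1..n}" "v \<in> {1..n}" "placement q e u = placement q e v"
  have inj: "a = b" if "height e (real a) = height e (real b)" "a \<le> n" "b \<le> n" for a b
    using height_inj[of "real n" e "real a" "real b"] that assms by auto
  have diffs: "u - q \<le> n" "v - q \<le> n" using uv by auto
  show "u = v"
    using uv inj[of u v] inj[of "u - q" "v - q", OF _ diffs]
    by (auto simp: placement_def split: if_splits simp del: of_nat_diff)
qed

lemma blocked_pair_eq_iff: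
  assumes "i \<le> q" "i < k" "u \<le> q" "q < v"
  shows "blocked_pair q (i, k) = {u, v} \<longleftrightarrow> i = u \<and> k = u + (v - q)"
  using assms by (auto simp: blocked_pair_def doubleton_eq_iff)

text \<open>One obstacle is used for each level occurring in \<open>S\<close>, and only
  \<open>r\<close> levels are available. It blocks exactly the pairs of \<open>S\<close> on its
  level.\<close>

lemma obstacle_number_graph_without:
  assumes n: "1 \<le> n" and qn: "2 * q \<le> n" and r: "r \<le> q"
    and S: "S \<subseteq> {1..q} \<times> {q+1..q+r}"
  shows "obstacle_number {1..n} (graph_without n q S) \<le> enat r"
proof -
  define e where "e = 1 / (16 * (real n)\<^sup>2)"
  define seg where "seg i j = closed_segment (0 :: real, height e (real i)) (1, height e (real j))" for i j :: nat
  have finS: "finite S" using S by (rule finite_subset) auto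
  define blocks where "blocks k P \<longleftrightarrow> polygon P \<and> (\<forall>z\<in>P. 0 < fst z \<and> fst z < 1) \<and>
      (\<forall>i j. i + j = k \<longrightarrow> (i, k) \<in> S \<longrightarrow> seg i j \<inter> P \<noteq> {}) \<and>
      (\<forall>i j. i + j \<le> n \<longrightarrow> (i + j = k \<longrightarrow> (i, k) \<notin> S) \<longrightarrow> seg i j \<inter> P = {})" for k P
  have "\<exists>P. blocks k P" if k: "k \<in> snd ` S" for k
  proof -
    let ?S = "{i. (i, k) \<in> S}"
    obtain i0 where "i0 \<in> ?S" using k by auto
    moreover have "finite ?S"
      using finite_imageI[OF finS, of fst] by (rule rev_finite_subset) force
    moreover have "k \<le> n" "\<forall>i\<in>?S. 1 \<le> i \<and> i < k" using S k qn r by auto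
    ultimately obtain P where "polygon P" "\<forall>z\<in>P. 0 < fst z \<and> fst z < 1"
      "\<And>i j. i + j = k \<Longrightarrow> i \<in> ?S \<Longrightarrow> seg i j \<inter> P \<noteq> {}"
      "\<And>i j. i + j \<le> n \<Longrightarrow> i + j = k \<longrightarrow> i \<notin> ?S \<Longrightarrow> seg i j \<inter> P = {}"
      using level_obstacle[OF n e_def, of k ?S i0] unfolding seg_def by blast
    then have "blocks k P" by (simp add: blocks_def)
    then show ?thesis ..
  qed
  then obtain P where blocks: "\<And>k. k \<in> snd ` S \<Longrightarrow> blocks k (P k)" by metis
  define Obs where "Obs = P ` snd ` S"
  have Obs: "\<exists>k\<in>snd ` S. blocks k T" if "T \<in> Obs" for T
    using that blocks by (auto simp: Obs_def)
  have strip: "0 < fst z \<and> fst z < 1" if "T \<in> Obs" "z \<in> T" for T z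
    using Obs[OF that(1)] that(2) by (auto simp: blocks_def)
  have miss: "seg i j \<inter> T = {}" if T: "T \<in> Obs" and ij: "i + j \<le> n" "(i, i + j) \<notin> S" for i j T
  proof -
    obtain k where "blocks k T" using Obs[OF T] by blast
    then show ?thesis using ij unfolding blocks_def by metis
  qed
  have hit: "\<exists>T\<in>Obs. seg i j \<inter> T \<noteq> {}" if "(i, i + j) \<in> S" for i j
  proof
    have k: "i + j \<in> snd ` S" using that by force
    show "seg i j \<inter> P (i + j) \<noteq> {}"
      using blocks[OF k] that unfolding blocks_def by blast
    show "P (i + j) \<in> Obs" using k by (simp add: Obs_def)
  qed
  let ?p = "placement q e"
  have cross: "{u, v} \<in> graph_without n q S \<longleftrightarrow> (\<forall>T\<in>Obs. closed_segment (?p u) (?p v) \<inter> T = {})"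
    if uv: "u \<in> {1..n}" "v \<in> {1..n}" "u \<le> q" "q < v" for u v
  proof -
    have seg: "closed_segment (?p u) (?p v) = seg u (v - q)"
      using uv by (simp add: placement_def seg_def)
    have "{u, v} = blocked_pair q x \<longleftrightarrow> x = (u, u + (v - q))" if "x \<in> S" for x
    proof -
      obtain i k where x: "x = (i, k)" by (cases x)
      then have "i \<le> q" "i < k" using that S by auto
      then show ?thesis using blocked_pair_eq_iff[of i q k u v] uv x by auto
    qed
    then have blocked: "{u, v} \<in> blocked_pair q ` S \<longleftrightarrow> (u, u + (v - q)) \<in> S"
      by (simp add: image_iff cong: bex_cong)
    \<comment> \<open>Since \<open>u \<le> q\<close>, every pair across the sides has level at most
      \<open>v\<close>, within the range where the obstacles are controlled.\<close>
    have "u + (v - q) \<le> n" using uv by auto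
    note hit_miss = hit[of u "v - q"] miss[OF _ this]
    have "{u, v} \<in> graph_without n q S \<longleftrightarrow> (u, u + (v - q)) \<notin> S"
      using uv blocked by (simp add: graph_without_def)
    also have "\<dots> \<longleftrightarrow> (\<forall>T\<in>Obs. seg u (v - q) \<inter> T = {})"
      using hit_miss by blast
    finally show ?thesis by (simp only: seg)
  qed
  \<comment> \<open>Blocked pairs always join the two sides, and a segment within one side stays on
    a boundary line of the open strip.\<close>
  have same_side: "{u, v} \<in> graph_without n q S \<and> (\<forall>T\<in>Obs. closed_segment (?p u) (?p v) \<inter> T = {})"
    if uv: "u \<in> {1..n}" "v \<in> {1..n}" "u \<noteq> v" "u \<le> q \<longleftrightarrow> v \<le> q" for u v
  proof
    have "{u, v} \<noteq> blocked_pair q x" if "x \<in> S" for x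
    proof -
      obtain i k where x: "x = (i, k)" by (cases x)
      then have "i \<le> q" "q < q + (k - i)" using that S by auto
      then show ?thesis using uv(4) by (simp add: x blocked_pair_def doubleton_eq_iff) linarith
    qed
    then have "{u, v} \<notin> blocked_pair q ` S" by (simp add: image_iff)
    then show "{u, v} \<in> graph_without n q S"
      using uv by (simp add: graph_without_def)
    have "fst (?p u) = fst (?p v)" "fst (?p u) = 0 \<or> fst (?p u) = 1"
      using uv by (simp_all add: placement_def)
    then have "fst z = 0 \<or> fst z = 1" if "z \<in> closed_segment (?p u) (?p v)" for z
      using that by (auto simp: in_segment)
    then show "\<forall>T\<in>Obs. closed_segment (?p u) (?p v) \<inter> T = {}"
      using strip by fastforce
  qed
  have adjacent: "{u, v} \<in> graph_without n q S \<longleftrightarrow> (\<forall>T\<in>Obs. closed_segment (?p u) (?p v) \<inter> T = {})"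
    if uv: "u \<in> {1..n}" "v \<in> {1..n}" "u \<noteq> v" for u v
  proof -
    consider "u \<le> q" "q < v" | "v \<le> q" "q < u" | "u \<le> q \<longleftrightarrow> v \<le> q" by linarith
    then show ?thesis
    proof cases
      case 1
      then show ?thesis using cross uv by simp
    next
      case 2
      have "{u, v} = {v, u}" "closed_segment (?p u) (?p v) = closed_segment (?p v) (?p u)"
        by (auto simp: closed_segment_commute)
      then show ?thesis using cross[of v u] uv 2 by (simp only:)
    next
      case 3
      then show ?thesis using same_side uv by blast
    qed
  qed
  have "obstacle_representation {1..n} (graph_without n q S) ?p Obs"
    unfolding obstacle_representation_def
    using inj_on_placement[OF n e_def] Obs adjacent by (simp add: blocks_def)
  moreover have "finite Obs" using finS by (simp add: Obs_def)
  ultimately have "\<exists>p O'. enat (card Obs) = enat (card O') \<and> finite O' \<and>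
      obstacle_representation {1..n} (graph_without n q S) p O'"
    by (intro exI[of _ ?p] exI[of _ Obs] conjI refl)
  then have "obstacle_number {1..n} (graph_without n q S) \<le> enat (card Obs)"
    unfolding obstacle_number_def by (intro Inf_lower CollectI)
  also have "card Obs \<le> card (snd ` S)"
    unfolding Obs_def using finS by (intro card_image_le) auto
  also have "card (snd ` S) \<le> card {q+1..q+r}" using S by (intro card_mono) auto
  finally show ?thesis by simp
qed

text \<open>Each of the \<open>q * r\<close> pairs in the grid may be blocked independently. Levels
  start at \<open>q + 1\<close> so that every left vertex has a partner of positive index; the
  largest partner is the vertex \<open>2 * q + r - 1\<close>, which is at most
  \<open>3 * q - 1\<close> and hence at most \<open>n\<close>.\<close>

lemma num_graphs_obs_le_ge:
  assumes n: "1 \<le> n" and qn: "3 * q \<le> n + 1" and r: "r \<le> q" "r \<le> h" "1 \<le> q"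
  shows "num_graphs_obs_le h n \<ge> 2 ^ (q * r)"
proof -
  let ?F = "{1..q} \<times> {q+1..q+r}"
  let ?G = "{E \<in> labeled_graphs n. obstacle_number {1..n} E \<le> enat h}"
  let ?A = "{e. e \<subseteq> {1..n} \<and> card e = 2}"
  have pair: "blocked_pair q ` ?F \<subseteq> ?A"
    using qn r by (auto simp: blocked_pair_def)
  have "inj_on (blocked_pair q) ?F"
    by (auto simp: inj_on_def blocked_pair_def doubleton_eq_iff)
  then have "inj_on (graph_without n q) (Pow ?F)"
  proof (intro inj_onI)
    fix S T assume ST: "S \<in> Pow ?F" "T \<in> Pow ?F" "graph_without n q S = graph_without n q T"
    \<comment> \<open>The non-edges recover the blocked pairs, and these recover the chosen
      set.\<close>
    have complement: "?A - graph_without n q R = blocked_pair q ` R" if "R \<subseteq> ?F" for R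
      unfolding graph_without_def
      using subset_trans[OF image_mono[OF that] pair] by (rule double_diff) simp
    have "blocked_pair q ` S = blocked_pair q ` T"
      using ST complement[of S] complement[of T] by (simp only: Pow_iff)
    then show "S = T"
      using ST \<open>inj_on (blocked_pair q) ?F\<close> by (simp add: inj_on_image_eq_iff)
  qed
  moreover have "graph_without n q ` Pow ?F \<subseteq> ?G"
  proof -
    have "obstacle_number {1..n} (graph_without n q S) \<le> enat h" if "S \<subseteq> ?F" for S
    proof -
      have "obstacle_number {1..n} (graph_without n q S) \<le> enat r"
        using that qn r n by (intro obstacle_number_graph_without) auto
      also have "enat r \<le> enat h" using r by simp
      finally show ?thesis .
    qed
    then show ?thesis by (auto simp: labeled_graphs_def graph_without_def)
  qed
  moreover have "finite ?G"
    by (rule finite_subset[of _ "Pow (Pow {1..n})"]) (auto simp: labeled_graphs_def)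
  ultimately have "card (Pow ?F) \<le> card ?G"
    by (intro card_inj_on_le)
  then show ?thesis
    by (simp add: num_graphs_obs_le_def card_Pow)
qed

theorem theorem4:
  "\<exists>c::real. c > 0 \<and>
     (\<forall>n h :: nat. 0 < h \<and> h < n \<longrightarrow>
        real (num_graphs_obs_le h n) \<ge> 2 powr (c * real h * real n))"
proof (intro exI[of _ "1/16"] conjI allI impI)
  fix n h :: nat assume nh: "0 < h \<and> h < n"
  \<comment> \<open>This is n/4 rounded up. The bound \<open>3 * q \<le> n + 1\<close> would fail
    for \<open>n = 1\<close>, which \<open>0 < h\<close> and \<open>h < n\<close> exclude.\<close>
  define q where "q = (n + 3) div 4"
  define r where "r = min h q"
  have q: "1 \<le> q" "3 * q \<le> n + 1" "n \<le> 4 * q" using nh by (auto simp: q_def)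
  \<comment> \<open>If the minimum \<open>r\<close> is \<open>q\<close>, then
    \<open>h < n \<le> 4 * q\<close> still gives \<open>h / 4 \<le> r\<close>. The two quarters
    produce the constant 1/16.\<close>
  have "real n / 4 * (real h / 4) \<le> real q * real r"
    using q nh by (intro mult_mono) (auto simp: r_def)
  then have "2 powr (1/16 * real h * real n) \<le> 2 powr real (q * r)"
    by (intro powr_mono) (auto simp: mult.commute)
  also have "\<dots> = real (2 ^ (q * r))" by (simp add: powr_realpow del: of_nat_mult)
  also have "\<dots> \<le> real (num_graphs_obs_le h n)"
    using num_graphs_obs_le_ge[of n q r h] q nh by (simp only: of_nat_le_iff) (simp add: r_def)
  finally show "2 powr (1/16 * real h * real n) \<le> real (num_graphs_obs_le h n)" .
qed simp

end
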